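(* Let $p\ge 1$ be an integer. Each mapping $F\in\mathcal{HC}_p$ is convex.
   Context: $\mathbb{D}=\{z\in\mathbb{C}:|z|<1\}$. For an integer $p\ge1$, $\mathcal{H}_p$ is the set of polyharmonic mappings $F$ in $\mathbb{D}$ of the form $$F(z)=\sum_{k=1}^{p}|z|^{2(k-1)}\big(h_k(z)+\overline{g_k(z)}\big)=\sum_{k=1}^{p}|z|^{2(k-1)}\sum_{j=1}^{\infty}\big(a_{k,j}z^j+\overline{b_{k,j}}\,\overline{z^j}\big),$$ with $h_k(z)=\sum_{j\ge1}a_{k,j}z^j$, $g_k(z)=\sum_{j\ge1}b_{k,j}z^j$ analytic in $\mathbb{D}$, $a_{1,1}=1$, $|b_{1,1}|<1$. $\mathcal{HC}_p$ is the class of $F\in\mathcal{H}_p$ satisfying $$\sum_{k=1}^{p}\sum_{j=2}^{\infty}\big(2(k-1)+j^2\big)\big(|a_{k,j}|+|b_{k,j}|\big)\le 1-|b_{1,1}|-\sum_{k=2}^{p}(2k-1)\big(|a_{k,1}|+|b_{k,1}|\big)$$ and $$0\le |b_{1,1}|+\sum_{k=2}^{p}(2k-1)\big(|a_{k,1}|+|b_{k,1}|\big)<1.$$ A univalent (i.e. injective) polyharmonic mapping $F$ of $\mathbb{D}$ with $F(0)=0$ and $\frac{\partial}{\partial\theta}F(re^{i\theta})\ne0$ whenever $r\in(0,1)$ is called convex if for each $r\in(0,1)$ the closed curve $\theta\mapsto F(re^{i\theta})$ is convex (i.e. the domain it bounds is convex). *)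

theory Defs
  imports "HOL-Complex_Analysis.Complex_Analysis"
begin

abbreviation unit_disc :: "complex set" (\<open>\<bbbD>\<close>)
  where "\<bbbD> \<equiv> ball 0 1"

definition dir_deriv :: "complex \<Rightarrow> (complex \<Rightarrow> complex) \<Rightarrow> complex \<Rightarrow> complex"
  where "dir_deriv v F z = frechet_derivative F (at z) v"

text \<open>Real differentiability, with \<open>\<complex>\<close> as a two-dimensional real space; \<open>S\<close> is meant to be open.\<close>

fun times_cont_diff_on :: "nat \<Rightarrow> complex set \<Rightarrow> (complex \<Rightarrow> complex) \<Rightarrow> bool"
  where
    "times_cont_diff_on 0 S F \<longleftrightarrow> continuous_on S F"
  | "times_cont_diff_on (Suc n) S F \<longleftrightarrow>
       (\<forall>z\<in>S. F differentiable (at z)) \<and> (\<forall>v. times_cont_diff_on n S (dir_deriv v F))"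

definition laplacian :: "(complex \<Rightarrow> complex) \<Rightarrow> complex \<Rightarrow> complex"
  where "laplacian F z = dir_deriv 1 (dir_deriv 1 F) z + dir_deriv \<i> (dir_deriv \<i> F) z"

definition polyharmonic_on :: "nat \<Rightarrow> complex set \<Rightarrow> (complex \<Rightarrow> complex) \<Rightarrow> bool"
  where "polyharmonic_on p S F \<longleftrightarrow>
    times_cont_diff_on (2 * p) S F \<and> (\<forall>z\<in>S. (laplacian ^^ p) F z = 0)"

definition polyharmonic_expansion ::
    "nat \<Rightarrow> (nat \<Rightarrow> nat \<Rightarrow> complex) \<Rightarrow> (nat \<Rightarrow> nat \<Rightarrow> complex) \<Rightarrow> (complex \<Rightarrow> complex) \<Rightarrow> bool"
  where "polyharmonic_expansion p a b F \<longleftrightarrow>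
    (\<exists>h g :: nat \<Rightarrow> complex \<Rightarrow> complex.
       (\<forall>k\<in>{1..p}. h k analytic_on \<bbbD> \<and> g k analytic_on \<bbbD> \<and>
          (\<forall>z\<in>\<bbbD>. ((\<lambda>j. a k j * z ^ j) has_sum h k z) {1..} \<and>
                  ((\<lambda>j. b k j * z ^ j) has_sum g k z) {1..})) \<and>
       (\<forall>z\<in>\<bbbD>. F z = (\<Sum>k=1..p. of_real (norm z ^ (2 * (k - 1))) * (h k z + cnj (g k z))))) \<and>
    a 1 1 = 1 \<and> norm (b 1 1) < 1"

text \<open>
  The values of the mappings outside \<open>\<bbbD>\<close> are irrelevant. Polyharmonicity is not a separate
  requirement in \<open>H_class\<close>: it follows from the form of the mappings.
\<close>

definition H_class :: "nat \<Rightarrow> (complex \<Rightarrow> complex) set"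
  where "H_class p = {F. \<exists>a b. polyharmonic_expansion p a b F}"

text \<open>
  The coefficients \<open>a k j\<close>, \<open>b k j\<close> with \<open>1 \<le> k \<le> p\<close> and \<open>1 \<le> j\<close> are uniquely determined
  by \<open>F\<close> on \<open>\<bbbD>\<close>, so the existential quantifier just names them. The summability condition
  expresses that the double sum in the inequality is finite.
\<close>

definition HC_class :: "nat \<Rightarrow> (complex \<Rightarrow> complex) set"
  where "HC_class p = {F \<in> H_class p. \<exists>a b. polyharmonic_expansion p a b F \<and>
    (\<forall>k\<in>{1..p}. (\<lambda>j. real (2 * (k - 1) + j\<^sup>2) * (norm (a k j) + norm (b k j))) summable_on {2..}) \<and>
    (\<Sum>k=1..p. \<Sum>\<^sub>\<infinity>j\<in>{2..}. real (2 * (k - 1) + j\<^sup>2) * (norm (a k j) + norm (b k j)))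
      \<le> 1 - norm (b 1 1) - (\<Sum>k=2..p. real (2 * k - 1) * (norm (a k 1) + norm (b k 1))) \<and>
    0 \<le> norm (b 1 1) + (\<Sum>k=2..p. real (2 * k - 1) * (norm (a k 1) + norm (b k 1))) \<and>
    norm (b 1 1) + (\<Sum>k=2..p. real (2 * k - 1) * (norm (a k 1) + norm (b k 1))) < 1}"

text \<open>
  By injectivity the curve \<open>\<theta> \<mapsto> F (r e\<^sup>i\<^sup>\<theta>)\<close> is a Jordan curve, so \<open>inside\<close> yields the domain it bounds.
\<close>

definition convex_polyharmonic :: "nat \<Rightarrow> (complex \<Rightarrow> complex) \<Rightarrow> bool"
  where "convex_polyharmonic p F \<longleftrightarrow>
    polyharmonic_on p \<bbbD> F \<and> inj_on F \<bbbD> \<and> F 0 = 0 \<and>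
    (\<forall>r\<in>{0<..<1}. \<forall>\<theta>::real. \<exists>D. D \<noteq> 0 \<and>
       ((\<lambda>t. F (of_real r * cis t)) has_vector_derivative D) (at \<theta>)) \<and>
    (\<forall>r\<in>{0<..<1}. convex (inside ((\<lambda>\<theta>. F (of_real r * cis \<theta>)) ` {0..2 * pi})))"

end

theory Submission
  imports Defs
begin

text \<open>
  Write $F(z) = z + \sum_i c_i e_i(z)$, where $i = (k, n)$ runs over $1 \le k \le p$, $n \ne 0$,
  $(k, n) \ne (1, 1)$, and $e_{(k,n)}(z)$ is $|z|^{2(k-1)}$ times $z^n$ or $\bar z^{-n}$. The hypothesis
  says that $\sum_i (2(k-1) + n^2) |c_i| \le 1$ and that the terms with $|n| = 1$ alone give a sum
  $< 1$; hence the sum becomes $L < 1$ as soon as the terms with $|n| \ge 2$ are damped by a factor $\rho < 1$.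
  On $|z| \le \rho$ the map $e_i$ has Lipschitz constant at most its damped weight, so
  $|F(z) - F(w)| \ge (1 - L) |z - w|$, which gives injectivity and the nonvanishing of the tangent.

  On $|z| = r$ the curve is $\gamma(\theta) = \sum_n \alpha_n e^{in\theta}$ with
  $\sum_{n \ne 1} n^2 |\alpha_n| < |\alpha_1|$. Its outer normal at $\theta$ is
  $V = \sum_n n \alpha_n e^{in\theta}$, and an estimate of $1 - e^{in\phi} - n (1 - e^{i\phi})$ shows directly
  that $\gamma$ lies on one side of its tangent at $\theta$. So $\gamma$ avoids the interior of its convex
  hull, and this interior is then the inside of $\gamma$.

  Polyharmonicity: the Laplacian maps $f \bar g$ to $4 f' \overline{g'}$ for holomorphic $f$, $g$, and
  $F$ is a sum of such products in which one factor is $z^{k-1}$ with $k \le p$.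
\<close>

subsection \<open>Polyharmonicity\<close>

text \<open>The parameter \<open>m\<close> bounds the number of Laplacians needed to annihilate the mapping.\<close>

inductive sesquiholomorphic :: "nat \<Rightarrow> (complex \<Rightarrow> complex) \<Rightarrow> bool" for m :: nat where
  prod: "f holomorphic_on \<bbbD> \<Longrightarrow> g holomorphic_on \<bbbD> \<Longrightarrow>
    (\<forall>z\<in>\<bbbD>. (deriv ^^ m) f z = 0) \<or> (\<forall>z\<in>\<bbbD>. (deriv ^^ m) g z = 0) \<Longrightarrow>
    (\<And>z. z \<in> \<bbbD> \<Longrightarrow> G z = c * f z * cnj (g z)) \<Longrightarrow> sesquiholomorphic m G"
| add: "sesquiholomorphic m G1 \<Longrightarrow> sesquiholomorphic m G2 \<Longrightarrow>
    (\<And>z. z \<in> \<bbbD> \<Longrightarrow> G z = G1 z + G2 z) \<Longrightarrow> sesquiholomorphic m G"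

lemma dir_deriv_eqI: "(F has_derivative F') (at z) \<Longrightarrow> dir_deriv v F z = F' v"
  unfolding dir_deriv_def by (metis frechet_derivative_at)

lemma higher_deriv_zero:
  assumes "(f :: complex \<Rightarrow> complex) holomorphic_on \<bbbD>" "\<forall>z\<in>\<bbbD>. (deriv ^^ m) f z = 0"
  shows "\<forall>z\<in>\<bbbD>. (deriv ^^ m) (deriv f) z = 0"
proof
  fix z :: complex assume z: "z \<in> \<bbbD>"
  have "(deriv ^^ m) (deriv f) z = deriv ((deriv ^^ m) f) z"
    by (metis funpow_swap1)
  also have "\<dots> = deriv (\<lambda>_. 0) z"
    using assms(2) z by (intro complex_derivative_transform_within_open[of _ \<bbbD>])
      (auto intro!: holomorphic_higher_deriv assms(1))
  finally show "(deriv ^^ m) (deriv f) z = 0" by simp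
qed

lemma has_derivative_prod_cnj:
  assumes "f holomorphic_on \<bbbD>" "g holomorphic_on \<bbbD>" "z \<in> \<bbbD>"
    and G: "\<And>w. w \<in> \<bbbD> \<Longrightarrow> G w = c * f w * cnj (g w)"
  shows "(G has_derivative (\<lambda>v. c * (v * deriv f z) * cnj (g z) + c * f z * cnj (v * deriv g z))) (at z)"
proof -
  have f: "(f has_derivative (\<lambda>v. deriv f z * v)) (at z)"
    using holomorphic_derivI[OF assms(1) open_ball assms(3)] by (simp add: has_field_derivative_def)
  have g: "(g has_derivative (\<lambda>v. deriv g z * v)) (at z)"
    using holomorphic_derivI[OF assms(2) open_ball assms(3)] by (simp add: has_field_derivative_def)
  have "((\<lambda>w. c * f w * cnj (g w)) has_derivative
      (\<lambda>v. c * (v * deriv f z) * cnj (g z) + c * f z * cnj (v * deriv g z))) (at z)"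
    by (rule has_derivative_eq_rhs, rule has_derivative_mult, rule has_derivative_mult_right, rule f,
        rule has_derivative_cnj, rule g) (auto simp: algebra_simps)
  then show ?thesis
    by (rule has_derivative_transform_within_open[of _ _ _ _ \<bbbD>]) (use assms in auto)
qed

lemma dir_deriv_prod_cnj:
  assumes "f holomorphic_on \<bbbD>" "g holomorphic_on \<bbbD>" "z \<in> \<bbbD>"
    and "\<And>w. w \<in> \<bbbD> \<Longrightarrow> G w = c * f w * cnj (g w)"
  shows "dir_deriv v G z = c * v * deriv f z * cnj (g z) + c * cnj v * f z * cnj (deriv g z)"
  by (subst dir_deriv_eqI[OF has_derivative_prod_cnj[OF assms]]) auto

lemma sesquiholomorphic_differentiable:
  "sesquiholomorphic m G \<Longrightarrow> z \<in> \<bbbD> \<Longrightarrow> G differentiable (at z)"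
proof (induction rule: sesquiholomorphic.induct)
  case (prod f g G c)
  show ?case
    using has_derivative_prod_cnj[OF prod(1,2,5,4)] unfolding differentiable_def by blast
next
  case (add G1 G2 G)
  then have "(\<lambda>w. G1 w + G2 w) differentiable (at z)"
    by (intro differentiable_add) auto
  then show ?case
    unfolding differentiable_def
    using has_derivative_transform_within_open[of "\<lambda>w. G1 w + G2 w" _ z UNIV \<bbbD> G] add by auto
qed

lemma dir_deriv_add:
  assumes "G1 differentiable (at z)" "G2 differentiable (at z)" "z \<in> \<bbbD>"
    and "\<And>w. w \<in> \<bbbD> \<Longrightarrow> G w = G1 w + G2 w"
  shows "dir_deriv v G z = dir_deriv v G1 z + dir_deriv v G2 z"
proof -
  obtain D1 D2 where D: "(G1 has_derivative D1) (at z)" "(G2 has_derivative D2) (at z)"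
    using assms unfolding differentiable_def by blast
  have "((\<lambda>w. G1 w + G2 w) has_derivative (\<lambda>v. D1 v + D2 v)) (at z)"
    by (rule has_derivative_add[OF D])
  then have "(G has_derivative (\<lambda>v. D1 v + D2 v)) (at z)"
    by (rule has_derivative_transform_within_open[of _ _ _ _ \<bbbD>]) (use assms in auto)
  then show ?thesis
    using D by (simp add: dir_deriv_eqI)
qed

text \<open>The derivative in direction \<open>v\<close> is \<open>v\<close> times the z-derivative
  plus \<open>cnj v\<close> times the derivative in the conjugate variable. Each of these acts on
  one factor only, so a product becomes a sum of two products, and a factor annihilated by
  \<open>m\<close> derivatives remains so.\<close>

lemma sesquiholomorphic_dir_deriv:
  "sesquiholomorphic m G \<Longrightarrow> sesquiholomorphic m (dir_deriv v G)"
proof (induction rule: sesquiholomorphic.induct)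
  case (prod f g G c)
  have hol: "deriv f holomorphic_on \<bbbD>" "deriv g holomorphic_on \<bbbD>"
    using prod by (auto intro: holomorphic_deriv)
  have 1: "sesquiholomorphic m (\<lambda>z. c * v * deriv f z * cnj (g z))"
    using prod hol higher_deriv_zero by (intro sesquiholomorphic.prod[of "deriv f" g]) auto
  have 2: "sesquiholomorphic m (\<lambda>z. c * cnj v * f z * cnj (deriv g z))"
    using prod hol higher_deriv_zero by (intro sesquiholomorphic.prod[of f "deriv g"]) auto
  show ?case
    by (rule sesquiholomorphic.add[OF 1 2]) (rule dir_deriv_prod_cnj[OF prod(1,2) _ prod(4)])
next
  case (add G1 G2 G)
  show ?case
    by (rule sesquiholomorphic.add[OF add.IH])
      (use add.hyps in \<open>auto intro!: dir_deriv_add intro: sesquiholomorphic_differentiable\<close>)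
qed

lemma sesquiholomorphic_times_cont_diff_on:
  "sesquiholomorphic m G \<Longrightarrow> times_cont_diff_on n \<bbbD> G"
proof (induction n arbitrary: G)
  case 0
  then show ?case
    by (auto intro!: continuous_at_imp_continuous_on differentiable_imp_continuous_within
        sesquiholomorphic_differentiable)
next
  case (Suc n)
  then show ?case
    using sesquiholomorphic_differentiable sesquiholomorphic_dir_deriv by auto
qed

lemma dir_deriv_dir_deriv_prod_cnj:
  assumes "f holomorphic_on \<bbbD>" "g holomorphic_on \<bbbD>" "z \<in> \<bbbD>"
    and "\<And>w. w \<in> \<bbbD> \<Longrightarrow> G w = c * f w * cnj (g w)"
  shows "dir_deriv v (dir_deriv v G) z = c * (v\<^sup>2 * deriv (deriv f) z * cnj (g z)
    + 2 * v * cnj v * deriv f z * cnj (deriv g z) + (cnj v)\<^sup>2 * f z * cnj (deriv (deriv g) z))"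
proof -
  have hol: "deriv f holomorphic_on \<bbbD>" "deriv g holomorphic_on \<bbbD>"
    using assms by (auto intro: holomorphic_deriv)
  let ?A = "\<lambda>z. c * v * deriv f z * cnj (g z)" and ?B = "\<lambda>z. c * cnj v * f z * cnj (deriv g z)"
  have "dir_deriv v (dir_deriv v G) z = dir_deriv v ?A z + dir_deriv v ?B z"
  proof (rule dir_deriv_add)
    show "?A differentiable at z"
      using has_derivative_prod_cnj[OF hol(1) assms(2,3), of ?A "c * v"] unfolding differentiable_def
      by blast
    show "?B differentiable at z"
      using has_derivative_prod_cnj[OF assms(1) hol(2) assms(3), of ?B "c * cnj v"]
      unfolding differentiable_def by blast
  qed (use assms in \<open>auto intro: dir_deriv_prod_cnj\<close>)
  also have "dir_deriv v ?A z = c * v * v * deriv (deriv f) z * cnj (g z) +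
      c * v * cnj v * deriv f z * cnj (deriv g z)"
    by (rule dir_deriv_prod_cnj[OF hol(1) assms(2,3)]) auto
  also have "dir_deriv v ?B z = c * cnj v * v * deriv f z * cnj (deriv g z) +
      c * cnj v * cnj v * f z * cnj (deriv (deriv g) z)"
    by (rule dir_deriv_prod_cnj[OF assms(1) hol(2) assms(3)]) auto
  finally show ?thesis
    by (simp add: algebra_simps power2_eq_square)
qed

text \<open>Summed over the directions 1 and \<open>\<i>\<close>, the terms with
  \<open>v\<^sup>2\<close> and \<open>(cnj v)\<^sup>2\<close> cancel, and the two mixed terms give
  \<open>4 * c * deriv f z * cnj (deriv g z)\<close>. Both factors have been differentiated once, so
  whichever factor was annihilated needs one derivative fewer.\<close>

lemma sesquiholomorphic_laplacian:
  "sesquiholomorphic (Suc m) G \<Longrightarrow> sesquiholomorphic m (laplacian G)"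
proof (induction rule: sesquiholomorphic.induct)
  case (prod f g G c)
  have "laplacian G z = 4 * c * deriv f z * cnj (deriv g z)" if z: "z \<in> \<bbbD>" for z
  proof -
    have "dir_deriv v (dir_deriv v G) z = c * (v\<^sup>2 * deriv (deriv f) z * cnj (g z)
      + 2 * v * cnj v * deriv f z * cnj (deriv g z) + (cnj v)\<^sup>2 * f z * cnj (deriv (deriv g) z))" for v
      by (rule dir_deriv_dir_deriv_prod_cnj[OF prod(1,2) z prod(4)])
    then show ?thesis
      unfolding laplacian_def by (simp add: algebra_simps)
  qed
  moreover have "(\<forall>z\<in>\<bbbD>. (deriv ^^ m) (deriv f) z = 0) \<or> (\<forall>z\<in>\<bbbD>. (deriv ^^ m) (deriv g) z = 0)"
    using prod(3) by (simp add: funpow_swap1)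
  ultimately show ?case
    using prod by (intro sesquiholomorphic.prod[of "deriv f" "deriv g" _ _ "4 * c"])
      (auto intro: holomorphic_deriv)
next
  case (add G1 G2 G)
  have *: "dir_deriv v (dir_deriv v G) z =
      dir_deriv v (dir_deriv v G1) z + dir_deriv v (dir_deriv v G2) z" if "z \<in> \<bbbD>" for v z
    using add.hyps that
    by (intro dir_deriv_add) (auto intro: sesquiholomorphic_differentiable sesquiholomorphic_dir_deriv)
  show ?case
    by (rule sesquiholomorphic.add[OF add.IH]) (simp add: laplacian_def *)
qed

lemma sesquiholomorphic_0: "sesquiholomorphic 0 G \<Longrightarrow> z \<in> \<bbbD> \<Longrightarrow> G z = 0"
  by (induction rule: sesquiholomorphic.induct) auto

lemma sesquiholomorphic_laplacian_iter:
  "sesquiholomorphic p G \<Longrightarrow> z \<in> \<bbbD> \<Longrightarrow> (laplacian ^^ p) G z = 0"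
proof (induction p arbitrary: G)
  case 0
  then show ?case using sesquiholomorphic_0 by simp
next
  case (Suc p)
  then show ?case
    unfolding funpow_Suc_right o_def by (blast intro: sesquiholomorphic_laplacian)
qed

lemma sesquiholomorphic_polyharmonic: "sesquiholomorphic p G \<Longrightarrow> polyharmonic_on p \<bbbD> G"
  by (simp add: polyharmonic_on_def sesquiholomorphic_times_cont_diff_on sesquiholomorphic_laplacian_iter)

lemma sesquiholomorphic_zero: "(\<And>z. z \<in> \<bbbD> \<Longrightarrow> G z = 0) \<Longrightarrow> sesquiholomorphic m G"
  by (rule sesquiholomorphic.prod[of "\<lambda>_. 0" "\<lambda>_. 0" _ _ 0]) (auto simp: higher_deriv_const)

lemma sesquiholomorphic_sum:
  assumes "finite K" "\<And>k. k \<in> K \<Longrightarrow> sesquiholomorphic m (f k)"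
  shows "sesquiholomorphic m (\<lambda>z. \<Sum>k\<in>K. f k z)"
  using assms
proof (induction K rule: finite_induct)
  case empty
  then show ?case by (intro sesquiholomorphic_zero) auto
next
  case (insert k K)
  have "sesquiholomorphic m (f k)" "sesquiholomorphic m (\<lambda>z. \<Sum>k\<in>K. f k z)"
    using insert by simp_all
  then show ?case
    by (rule sesquiholomorphic.add) (use insert.hyps in simp)
qed

text \<open>The rule \<open>add\<close> compares values on the disc only, so adding the zero map
  changes the values outside at will.\<close>

lemma sesquiholomorphic_cong:
  "sesquiholomorphic m G \<Longrightarrow> (\<And>z. z \<in> \<bbbD> \<Longrightarrow> G' z = G z) \<Longrightarrow> sesquiholomorphic m G'"
  by (rule sesquiholomorphic.add[of m G "\<lambda>_. 0"]) (auto intro: sesquiholomorphic_zero)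

text \<open>The falling factorial in front of the power is a \<open>pochhammer\<close> product
  running from n + 1 - m up to n, and it passes through 0.\<close>

lemma higher_deriv_power_eq_0: "n < m \<Longrightarrow> (deriv ^^ m) (\<lambda>w. w ^ n) (z::complex) = 0"
  using higher_deriv_power[of m 0 n z]
  by (simp add: pochhammer_eq_0_iff)

lemma expansion_polyharmonic:
  assumes "polyharmonic_expansion p a b F"
  shows "polyharmonic_on p \<bbbD> F"
proof -
  obtain h g where hol: "\<And>k. k \<in> {1..p} \<Longrightarrow> h k analytic_on \<bbbD> \<and> g k analytic_on \<bbbD>"
    and F: "\<And>z. z\<in>\<bbbD> \<Longrightarrow>
      F z = (\<Sum>k=1..p. of_real (norm z ^ (2 * (k - 1))) * (h k z + cnj (g k z)))"
    using assms unfolding polyharmonic_expansion_def by blast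
  have "sesquiholomorphic p (\<lambda>z. of_real (norm z ^ (2 * (k - 1))) * (h k z + cnj (g k z)))"
    if k: "k \<in> {1..p}" for k
  proof -
    \<comment> \<open>Write \<open>norm z ^ (2 * (k - 1))\<close> as \<open>z ^ (k - 1)\<close>
      times its conjugate. One of these two powers joins \<open>h k\<close> or \<open>g k\<close>;
      the other is left alone as a factor of degree below \<open>p\<close>, which \<open>p\<close>
      derivatives annihilate.\<close>
    have an: "\<forall>z. (deriv ^^ p) (\<lambda>w. w ^ (k - 1)) (z::complex) = 0"
      using k by (auto intro!: higher_deriv_power_eq_0)
    have h: "(\<lambda>z. z ^ (k-1) * h k z) holomorphic_on \<bbbD>" "(\<lambda>z. z ^ (k-1) * g k z) holomorphic_on \<bbbD>"
      using hol[OF k, THEN conjunct1, THEN analytic_imp_holomorphic]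
        hol[OF k, THEN conjunct2, THEN analytic_imp_holomorphic]
      by (auto intro!: holomorphic_intros)
    have q: "(\<lambda>z. z ^ (k-1)) holomorphic_on \<bbbD>"
      by (intro holomorphic_intros)
    have 1: "sesquiholomorphic p (\<lambda>z. 1 * (z ^ (k-1) * h k z) * cnj (z ^ (k-1)))"
      by (rule sesquiholomorphic.prod[OF h(1) q disjI2, where c = 1], use an in blast, rule refl)
    have 2: "sesquiholomorphic p (\<lambda>z. 1 * z ^ (k-1) * cnj (z ^ (k-1) * g k z))"
      by (rule sesquiholomorphic.prod[OF q h(2) disjI1, where c = 1], use an in blast, rule refl)
    show ?thesis
    proof (rule sesquiholomorphic.add[OF 1 2])
      fix z :: complex
      have "complex_of_real (norm z ^ (2 * (k - 1))) = of_real ((norm z)\<^sup>2) ^ (k-1)"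
        by (simp add: power_mult)
      also have "\<dots> = z ^ (k-1) * cnj (z ^ (k-1))"
        unfolding complex_norm_square by (simp add: power_mult_distrib)
      finally have "complex_of_real (norm z ^ (2 * (k - 1))) = z ^ (k-1) * cnj (z ^ (k-1))" .
      then show "complex_of_real (norm z ^ (2 * (k - 1))) * (h k z + cnj (g k z)) =
        1 * (z ^ (k-1) * h k z) * cnj (z ^ (k-1)) + 1 * z ^ (k-1) * cnj (z ^ (k-1) * g k z)"
        by (simp add: algebra_simps)
    qed
  qed
  then have "sesquiholomorphic p F"
    by (intro sesquiholomorphic_cong[OF sesquiholomorphic_sum F]) auto
  then show ?thesis
    by (rule sesquiholomorphic_polyharmonic)
qed

subsection \<open>Supporting lines of closed curves\<close>

text \<open>Telescoping as for the usual bound on the disc, but keeping the powers of the radius: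
  they supply the damping of the terms of degree at least 2.\<close>

lemma norm_power_diff_le_radius:
  fixes z w :: "'a::{real_normed_algebra_1, comm_ring_1}" and \<rho> :: real
  assumes "norm z \<le> \<rho>" "norm w \<le> \<rho>"
  shows "norm (z ^ Suc m - w ^ Suc m) \<le> Suc m * \<rho> ^ m * norm (z - w)"
proof (induction m)
  case (Suc m)
  have \<rho>: "0 \<le> \<rho>" using assms norm_ge_zero order_trans by blast
  have "z ^ Suc (Suc m) - w ^ Suc (Suc m) = z * (z ^ Suc m - w ^ Suc m) + (z - w) * w ^ Suc m"
    by (simp add: algebra_simps)
  also have "norm \<dots> \<le> \<rho> * (Suc m * \<rho> ^ m * norm (z - w)) + norm (z - w) * \<rho> ^ Suc m"
    by (intro norm_triangle_le add_mono order_trans[OF norm_mult_ineq] mult_mono Suc assms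
        order_trans[OF norm_power_ineq] power_mono) (auto simp: \<rho>)
  finally show ?case by (simp add: algebra_simps)
qed auto

text \<open>Put u = 1 - \<open>cis \<phi>\<close>, so that |u|^2 = 2 (1 -
  \<open>cos \<phi>\<close>). For n = m >= 0 the left side is the norm of a sum of u
  (\<open>cis (k * \<phi>)\<close> - 1) over k < m, each term at most k |u|^2, and the k add up to
  (m^2 - m) / 2. For n = -m the sum runs over k = 1, ..., m and gives (m^2 + m) / 2 instead, which
  is again (n^2 - n) / 2.\<close>

lemma cis_int_estimate:
  fixes n :: int and \<phi> :: real
  shows "norm (1 - cis (of_int n * \<phi>) - of_int n * (1 - cis \<phi>)) \<le> of_int (n\<^sup>2 - n) * (1 - cos \<phi>)"
proof -
  define u where "u = 1 - cis \<phi>"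
  have u2: "norm u * norm u = 2 * (1 - cos \<phi>)"
  proof -
    have "(norm u)\<^sup>2 = 2 - 2 * cos \<phi>"
      unfolding cmod_power2 u_def using sin_cos_squared_add[of \<phi>] by (simp add: power2_eq_square algebra_simps)
    then show ?thesis by (simp add: power2_eq_square)
  qed
  have chord: "norm (1 - cis (real m * \<phi>)) \<le> m * norm u" for m :: nat
    using norm_power_diff[of 1 "cis \<phi>" m] by (simp add: u_def flip: Complex.DeMoivre)
  have chord': "norm (1 - cis (- (real m * \<phi>))) \<le> m * norm u" for m :: nat
  proof -
    have "norm (1 - cis (- (real m * \<phi>))) = norm (cnj (1 - cis (real m * \<phi>)))"
      by (simp add: cis_cnj)
    then show ?thesis using chord[of m] by (simp only: complex_mod_cnj)
  qed
  have pos: "norm (1 - cis (real m * \<phi>) - of_nat m * u) \<le> (real m ^ 2 - real m) * (1 - cos \<phi>)" for m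
  proof (induction m)
    case (Suc m)
    have "1 - cis (real (Suc m) * \<phi>) - of_nat (Suc m) * u
      = (1 - cis (real m * \<phi>) - of_nat m * u) + u * (cis (real m * \<phi>) - 1)"
      by (simp add: u_def algebra_simps cis_mult)
    also have "norm \<dots> \<le> (real m ^ 2 - real m) * (1 - cos \<phi>) + norm u * (m * norm u)"
      unfolding norm_mult[of u] using chord[of m]
      by (intro norm_triangle_le add_mono Suc order_trans[OF eq_refl[OF norm_mult]] mult_left_mono)
        (auto simp: norm_minus_commute)
    also have "\<dots> = (real (Suc m) ^ 2 - real (Suc m)) * (1 - cos \<phi>)"
      unfolding mult.left_commute[of "norm u"] u2 by (simp add: algebra_simps power2_eq_square)
    finally show ?case .
  qed auto
  have neg: "norm (1 - cis (- (real m * \<phi>)) + of_nat m * u) \<le> (real m ^ 2 + real m) * (1 - cos \<phi>)" for m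
  proof (induction m)
    case (Suc m)
    have "1 - cis (- (real (Suc m) * \<phi>)) + of_nat (Suc m) * u
      = (1 - cis (- (real m * \<phi>)) + of_nat m * u) + u * (1 - cis (- (real (Suc m) * \<phi>)))"
      by (simp add: u_def algebra_simps cis_mult)
    also have "norm \<dots> \<le> (real m ^ 2 + real m) * (1 - cos \<phi>) + norm u * (real (Suc m) * norm u)"
      using chord'[of "Suc m"]
      by (intro norm_triangle_le add_mono Suc order_trans[OF eq_refl[OF norm_mult]] mult_left_mono) auto
    also have "\<dots> = (real (Suc m) ^ 2 + real (Suc m)) * (1 - cos \<phi>)"
      unfolding mult.left_commute[of "norm u"] u2 by (simp add: algebra_simps power2_eq_square)
    finally show ?case .
  qed auto
  show ?thesis
  proof (cases "n \<ge> 0")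
    case True
    then obtain m where "n = int m" using nonneg_int_cases by blast
    then show ?thesis using pos[of m] by (simp add: u_def)
  next
    case False
    then obtain m where "n = - int m" by (metis int_cases of_nat_0_le_iff)
    then show ?thesis using neg[of m] by (simp add: u_def)
  qed
qed

text \<open>Polarization: |U + V|^2 - |U - V|^2 = 4 \<open>Re (cnj V * U)\<close>. It turns a
  comparison of norms into a statement about sides of a line.\<close>

lemma norm_add_le_imp_Re_nonneg:
  fixes U V :: complex
  assumes "norm (U - V) \<le> norm (U + V)"
  shows "0 \<le> Re (cnj V * U)"
proof -
  have "(norm (U - V))\<^sup>2 \<le> (norm (U + V))\<^sup>2"
    using assms by (rule power_mono) simp
  then show ?thesis
    unfolding cmod_power2 by (simp add: power2_eq_square algebra_simps)
qed

text \<open>The base point of the curve is \<open>\<phi> = 0\<close>, and \<open>V\<close> is the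
  tangent there divided by \<open>\<i>\<close>; it is nonzero since |n| <= n^2 makes its
  perturbation smaller than \<open>norm \<alpha>\<close>. The index is kept apart from the
  frequency: several indices may share one, and \<open>J\<close> may contain frequency 1 besides the
  leading term.\<close>

lemma trigonometric_series_support:
  fixes n :: "'i \<Rightarrow> int" and d :: "'i \<Rightarrow> complex" and \<alpha> s :: complex
  assumes M: "((\<lambda>i. (of_int (n i))\<^sup>2 * norm (d i)) has_sum M) J" "M < norm \<alpha>"
    and s: "(d has_sum s) J"
  shows "\<exists>V. V \<noteq> 0 \<and> (\<forall>\<phi> t. ((\<lambda>i. d i * cis (of_int (n i) * \<phi>)) has_sum t) J \<longrightarrow>
      Re (cnj V * (\<alpha> * cis \<phi> + t)) \<le> Re (cnj V * (\<alpha> + s)))"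
proof -
  have abs_le: "\<bar>real_of_int m\<bar> \<le> (of_int m)\<^sup>2" for m
  proof -
    have "\<bar>m\<bar> \<le> m\<^sup>2"
      using self_le_power[of "\<bar>m\<bar>" 2] by (cases "m = 0") auto
    then show ?thesis by (metis of_int_abs of_int_le_iff of_int_power)
  qed
  have nd_abs: "norm (of_int (n i) * d i) \<le> (of_int (n i))\<^sup>2 * norm (d i)" for i
    using abs_le[of "n i"] by (auto simp: norm_mult intro: mult_right_mono)
  have "(\<lambda>i. of_int (n i) * d i) summable_on J"
    by (rule abs_summable_summable, rule Infinite_Sum.abs_summable_on_comparison_test'[OF has_sum_imp_summable[OF M(1)]])
      (rule nd_abs)
  then obtain S where S: "((\<lambda>i. of_int (n i) * d i) has_sum S) J"
    by (auto simp: summable_on_def)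
  define V where "V = \<alpha> + S"
  have "norm S \<le> M" by (rule norm_infsum_le[OF S M(1)]) (rule nd_abs)
  then have V0: "V \<noteq> 0"
    using M(2) unfolding V_def by (metis add_eq_0_iff norm_minus_cancel not_le)
  have "Re (cnj V * (\<alpha> * cis \<phi> + t)) \<le> Re (cnj V * (\<alpha> + s))"
    if t: "((\<lambda>i. d i * cis (of_int (n i) * \<phi>)) has_sum t) J" for \<phi> t
  proof -
    define \<sigma> where "\<sigma> = 1 - cos \<phi>"
    have \<sigma>: "\<sigma> \<ge> 0" by (simp add: \<sigma>_def)
    \<comment> \<open>The tangential term added to the chord \<open>X\<close> does not change \<open>Re (cnj V * X)\<close>, but it makes \<open>U\<close>
      of the same order \<open>\<sigma>\<close> as the claim, so that \<open>U\<close> can be compared with \<open>\<sigma> V\<close> term by term.\<close>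
    define X where "X = (\<alpha> + s) - (\<alpha> * cis \<phi> + t)"
    define U where "U = X + \<i> * of_real (sin \<phi>) * V"
    \<comment> \<open>The factor with which frequency \<open>m\<close> enters
      \<open>U\<close>.\<close>
    define q where "q m = 1 - cis (of_int m * \<phi>) + \<i> * of_real (sin \<phi>) * of_int m" for m :: int
    have qm: "norm (q m - of_real \<sigma> * of_int m) \<le> of_int (m\<^sup>2 - m) * \<sigma>" for m
    proof -
      have "q m - of_real \<sigma> * of_int m = 1 - cis (of_int m * \<phi>) - of_int m * (1 - cis \<phi>)"
        by (simp add: q_def \<sigma>_def complex_eq_iff algebra_simps)
      then show ?thesis using cis_int_estimate[of m \<phi>] by (simp add: \<sigma>_def)
    qed
    \<comment> \<open>Conjugation exchanges \<open>m\<close> and \<open>- m\<close>, so the previous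
      bound at \<open>- m\<close> applies.\<close>
    have qp: "norm (q m + of_real \<sigma> * of_int m) \<le> of_int (m\<^sup>2 + m) * \<sigma>" for m
    proof -
      have "q m + of_real \<sigma> * of_int m = cnj (q (- m) - of_real \<sigma> * of_int (- m))"
        by (simp add: q_def complex_eq_iff)
      then show ?thesis using qm[of "- m"] by (simp only: complex_mod_cnj) simp
    qed
    have Xsum: "((\<lambda>i. d i - d i * cis (of_int (n i) * \<phi>)) has_sum (s - t)) J"
      using has_sum_add[OF s has_sum_uminusI[OF t]] by simp
    have Usum: "((\<lambda>i. d i * q (n i)) has_sum (s - t + \<i> * of_real (sin \<phi>) * S)) J"
      using has_sum_add[OF Xsum has_sum_cmult_right[OF S, of "\<i> * of_real (sin \<phi>)"]]
      by (simp add: q_def algebra_simps)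
    \<comment> \<open>Since \<open>q 1 = \<sigma>\<close>, the leading term contributes exactly
      \<open>\<sigma> * \<alpha>\<close>.\<close>
    have U: "U = of_real \<sigma> * \<alpha> + (s - t + \<i> * of_real (sin \<phi>) * S)"
      unfolding U_def X_def V_def \<sigma>_def by (simp add: complex_eq_iff algebra_simps)
    \<comment> \<open>The linear part of n^2 - n and n^2 + n. It lowers the upper bound for the norm
      of U - \<open>\<sigma>\<close> V and the lower bound for the norm of U +
      \<open>\<sigma>\<close> V by the same amount, so comparing the two leaves only
      \<open>M\<close> against \<open>norm \<alpha>\<close>.\<close>
    define Sr where "Sr = (\<Sum>\<^sub>\<infinity>i\<in>J. of_int (n i) * norm (d i))"
    have "(\<lambda>i. of_int (n i) * norm (d i)) summable_on J"
      by (rule abs_summable_summable, rule Infinite_Sum.abs_summable_on_comparison_test'[OF has_sum_imp_summable[OF M(1)]])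
        (use nd_abs in \<open>simp add: norm_mult abs_mult\<close>)
    then have Sr: "((\<lambda>i. of_int (n i) * norm (d i)) has_sum Sr) J"
      unfolding Sr_def by (rule has_sum_infsum)
    have "norm (s - t + \<i> * of_real (sin \<phi>) * S - of_real \<sigma> * S) \<le> \<sigma> * (M - Sr)"
    proof (rule norm_infsum_le)
      show "((\<lambda>i. d i * (q (n i) - of_real \<sigma> * of_int (n i))) has_sum (s - t + \<i> * of_real (sin \<phi>) * S - of_real \<sigma> * S)) J"
        using has_sum_add[OF Usum has_sum_uminusI[OF has_sum_cmult_right[OF S, of "of_real \<sigma>"]]]
        by (simp add: algebra_simps)
      show "((\<lambda>i. \<sigma> * ((of_int (n i))\<^sup>2 * norm (d i) - of_int (n i) * norm (d i))) has_sum (\<sigma> * (M - Sr))) J"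
        using has_sum_cmult_right[OF has_sum_add[OF M(1) has_sum_uminusI[OF Sr]], of \<sigma>] by simp
      show "norm (d i * (q (n i) - of_real \<sigma> * of_int (n i)))
          \<le> \<sigma> * ((of_int (n i))\<^sup>2 * norm (d i) - of_int (n i) * norm (d i))" for i
        using mult_left_mono[OF qm[of "n i"] norm_ge_zero[of "d i"]] unfolding norm_mult by (simp add: algebra_simps)
    qed
    then have 1: "norm (U - of_real \<sigma> * V) \<le> \<sigma> * (M - Sr)"
      by (simp add: U V_def algebra_simps)
    have "norm (s - t + \<i> * of_real (sin \<phi>) * S + of_real \<sigma> * S) \<le> \<sigma> * (M + Sr)"
    proof (rule norm_infsum_le)
      show "((\<lambda>i. d i * (q (n i) + of_real \<sigma> * of_int (n i))) has_sum (s - t + \<i> * of_real (sin \<phi>) * S + of_real \<sigma> * S)) J"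
        using has_sum_add[OF Usum has_sum_cmult_right[OF S, of "of_real \<sigma>"]]
        by (simp add: algebra_simps)
      show "((\<lambda>i. \<sigma> * ((of_int (n i))\<^sup>2 * norm (d i) + of_int (n i) * norm (d i))) has_sum (\<sigma> * (M + Sr))) J"
        using has_sum_cmult_right[OF has_sum_add[OF M(1) Sr], of \<sigma>] by simp
      show "norm (d i * (q (n i) + of_real \<sigma> * of_int (n i)))
          \<le> \<sigma> * ((of_int (n i))\<^sup>2 * norm (d i) + of_int (n i) * norm (d i))" for i
        using mult_left_mono[OF qp[of "n i"] norm_ge_zero[of "d i"]] unfolding norm_mult by (simp add: algebra_simps)
    qed
    moreover have "U + of_real \<sigma> * V =
        2 * of_real \<sigma> * \<alpha> + (s - t + \<i> * of_real (sin \<phi>) * S + of_real \<sigma> * S)"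
      by (simp add: U V_def algebra_simps)
    moreover have "norm (2 * of_real \<sigma> * \<alpha>) = 2 * \<sigma> * norm \<alpha>"
      using \<sigma> by (simp add: norm_mult)
    ultimately have 2: "2 * \<sigma> * norm \<alpha> - \<sigma> * (M + Sr) \<le> norm (U + of_real \<sigma> * V)"
      by (smt (verit) norm_diff_ineq)
    have "norm (U - of_real \<sigma> * V) \<le> norm (U + of_real \<sigma> * V)"
    proof -
      have "\<sigma> * M \<le> \<sigma> * norm \<alpha>" using M(2) \<sigma> by (intro mult_left_mono) auto
      then show ?thesis using 1 2 by (simp add: algebra_simps)
    qed
    from norm_add_le_imp_Re_nonneg[OF this]
    have U\<sigma>: "0 \<le> \<sigma> * Re (cnj V * U)" by (simp add: algebra_simps)
    have UX: "Re (cnj V * U) = Re (cnj V * X)"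
      unfolding U_def by (simp add: algebra_simps)
    \<comment> \<open>If \<open>\<sigma> = 0\<close> one cannot cancel it from the inequality, but
      then the first estimate already forces \<open>U = 0\<close>.\<close>
    show ?thesis
    proof (cases "\<sigma> = 0")
      case True
      have "norm (U - of_real \<sigma> * V) \<le> 0" using 1 True by simp
      then have "U = 0" using True by simp
      then show ?thesis using UX unfolding X_def by (simp add: algebra_simps)
    next
      case False
      then have "0 \<le> Re (cnj V * X)" using U\<sigma> UX \<sigma> by (simp add: zero_le_mult_iff)
      then show ?thesis unfolding X_def by (simp add: algebra_simps)
    qed
  qed
  then show ?thesis using V0 by blast
qed

text \<open>A supporting line cannot pass through an interior point of the hull, so the interior of
  the hull misses the curve. It is connected and contains the inside, hence lies in a single
  component of the complement and equals the inside.\<close>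

lemma inside_convex_if_support:
  fixes \<gamma> :: "real \<Rightarrow> complex"
  assumes "simple_path \<gamma>" "pathfinish \<gamma> = pathstart \<gamma>"
    and supp: "\<And>x. x \<in> path_image \<gamma> \<Longrightarrow> \<exists>v. v \<noteq> 0 \<and> (\<forall>y\<in>path_image \<gamma>. v \<bullet> y \<le> v \<bullet> x)"
  shows "convex (inside (path_image \<gamma>))"
proof -
  let ?C = "path_image \<gamma>"
  let ?K = "convex hull ?C"
  have J: "inside ?C \<noteq> {}" "open (inside ?C)"
    using Jordan_inside_outside[OF assms(1,2)] by auto
  have disj: "interior ?K \<inter> ?C = {}"
  proof (rule ccontr)
    assume "\<not> ?thesis"
    then obtain x where x: "x \<in> interior ?K" "x \<in> ?C" by blast
    then obtain v where v: "v \<noteq> 0" "\<forall>y\<in>?C. v \<bullet> y \<le> v \<bullet> x" using supp by blast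
    have half: "?K \<subseteq> {y. v \<bullet> y \<le> v \<bullet> x}"
      by (rule hull_minimal) (use v in \<open>auto simp: convex_halfspace_le\<close>)
    have "interior ?K \<subseteq> {y. v \<bullet> y < v \<bullet> x}"
      using interior_mono[OF half] interior_halfspace_le[OF v(1)] by simp
    then show False using x by auto
  qed
  \<comment> \<open>The complement of a convex set containing the curve lies in the outside.\<close>
  have "inside ?C \<subseteq> ?K"
    using outside_subset_convex[of ?K ?C] hull_subset[of ?C convex] by (auto simp: inside_outside)
  then have sub: "inside ?C \<subseteq> interior ?K"
    using J(2) by (rule interior_maximal)
  have "interior ?K \<subseteq> inside ?C"
  proof
    fix y assume y: "y \<in> interior ?K"
    obtain x where x: "x \<in> inside ?C" using J by blast
    have "connected (interior ?K)" by (intro convex_connected convex_interior) auto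
    then have "connected_component (- ?C) x y"
      unfolding connected_component_def using x y sub disj by (intro exI[of _ "interior ?K"]) blast
    then show "y \<in> inside ?C" using inside_same_component x by blast
  qed
  with sub have "inside ?C = interior ?K" by blast
  then show ?thesis by simp
qed

subsection \<open>Expansion into modes\<close>

text \<open>Integer frequencies merge the analytic coefficients (positive) with the conjugated
  antianalytic ones (negative), so that on each circle the mapping is one series of the kind treated
  above.\<close>

definition harmonics :: "nat \<Rightarrow> (nat \<times> int) set"
  where "harmonics p = {1..p} \<times> - {0}"

definition mode :: "nat \<times> int \<Rightarrow> complex \<Rightarrow> complex"
  where "mode i z = of_real (norm z ^ (2 * (fst i - 1))) *
    (if snd i \<ge> 0 then z ^ nat (snd i) else cnj z ^ nat (- snd i))"

text \<open>A factor \<open>\<rho>\<close> is gained for \<open>\<bar>n\<bar> \<ge> 2\<close>, so that the sum in the hypothesis becomes strictly smaller.\<close>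

definition weight :: "real \<Rightarrow> nat \<times> int \<Rightarrow> real"
  where "weight \<rho> i = (real (2 * (fst i - 1)) + of_int ((snd i)\<^sup>2)) * (if \<bar>snd i\<bar> = 1 then 1 else \<rho>)"

definition mode_coeff ::
    "(nat \<Rightarrow> nat \<Rightarrow> complex) \<Rightarrow> (nat \<Rightarrow> nat \<Rightarrow> complex) \<Rightarrow> nat \<times> int \<Rightarrow> complex"
  where "mode_coeff a b i =
    (if snd i \<ge> 0 then a (fst i) (nat (snd i)) else cnj (b (fst i) (nat (- snd i))))"

lemma has_sum_harmonics:
  fixes f :: "nat \<times> int \<Rightarrow> 'a::{topological_comm_monoid_add, t2_space}"
  assumes "\<And>k. k \<in> {1..p} \<Longrightarrow> ((\<lambda>j. f (k, int j)) has_sum s k) {1..}"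
    and "\<And>k. k \<in> {1..p} \<Longrightarrow> ((\<lambda>j. f (k, - int j)) has_sum t k) {1..}"
  shows "(f has_sum (\<Sum>k=1..p. s k + t k)) (harmonics p)"
proof -
  have single: "(f has_sum (s k + t k)) ({k} \<times> - {0})" if k: "k \<in> {1..p}" for k
  proof -
    have "{k} \<times> - {0} = (\<lambda>j. (k, int j)) ` {1..} \<union> (\<lambda>j. (k, - int j)) ` {1..}"
    proof -
      have "(k, m) \<in> (\<lambda>j. (k, int j)) ` {1..} \<union> (\<lambda>j. (k, - int j)) ` {1..}" if "m \<noteq> 0" for m
      proof (cases "m > 0")
        case True
        then show ?thesis by (intro UnI1 image_eqI[of _ _ "nat m"]) auto
      next
        case False
        then show ?thesis using that by (intro UnI2 image_eqI[of _ _ "nat (- m)"]) auto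
      qed
      then show ?thesis by auto
    qed
    moreover have "(\<lambda>j. (k, int j)) ` {1..} \<inter> (\<lambda>j. (k, - int j)) ` {1..} = {}"
      by auto
    moreover have "(f has_sum s k) ((\<lambda>j. (k, int j)) ` {1..})"
      using assms(1)[OF k] by (subst has_sum_reindex) (auto simp: inj_on_def o_def)
    moreover have "(f has_sum t k) ((\<lambda>j. (k, - int j)) ` {1..})"
      using assms(2)[OF k] by (subst has_sum_reindex) (auto simp: inj_on_def o_def)
    ultimately show ?thesis
      by (simp only: has_sum_Un_disjoint)
  qed
  have "(f has_sum (\<Sum>k\<in>K. s k + t k)) (K \<times> - {0})" if "K \<subseteq> {1..p}" for K
    using finite_subset[OF that finite_atLeastAtMost] that
  proof (induction K rule: finite_induct)
    case (insert k K)
    have "insert k K \<times> - {0::int} = ({k} \<times> - {0}) \<union> (K \<times> - {0})" by blast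
    moreover have "(f has_sum ((s k + t k) + (\<Sum>k\<in>K. s k + t k))) (({k} \<times> - {0}) \<union> (K \<times> - {0}))"
      by (rule has_sum_Un_disjoint) (use insert single in auto)
    ultimately show ?case using insert by simp
  qed auto
  then show ?thesis unfolding harmonics_def by blast
qed

lemma has_sum_remove:
  fixes f :: "'i \<Rightarrow> 'a::banach"
  assumes "(f has_sum S) A" "x \<in> A"
  shows "(f has_sum (S - f x)) (A - {x})"
proof -
  have "f summable_on (A - {x})"
    by (rule summable_on_cofin_subset) (use assms in \<open>auto simp: summable_on_def\<close>)
  then obtain T where T: "(f has_sum T) (A - {x})" by (auto simp: summable_on_def)
  have "(f has_sum (f x + T)) A"
    using has_sum_insert[OF _ T, of x] assms(2) by (simp add: insert_absorb)
  then have "S = f x + T" using assms(1) has_sum_unique by blast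
  then show ?thesis using T by simp
qed

lemma expansion_has_sum_modes:
  assumes p: "p \<ge> 1" and "polyharmonic_expansion p a b F" and z: "z \<in> \<bbbD>"
  shows "((\<lambda>i. mode_coeff a b i * mode i z) has_sum (F z - z)) (harmonics p - {(1, 1)})"
proof -
  obtain h g where
    hs: "\<And>k. k \<in> {1..p} \<Longrightarrow> ((\<lambda>j. a k j * z ^ j) has_sum h k z) {1..}"
    and gs: "\<And>k. k \<in> {1..p} \<Longrightarrow> ((\<lambda>j. b k j * z ^ j) has_sum g k z) {1..}"
    and F: "F z = (\<Sum>k=1..p. of_real (norm z ^ (2 * (k - 1))) * (h k z + cnj (g k z)))"
    and a11: "a 1 1 = 1"
    using assms unfolding polyharmonic_expansion_def by blast
  let ?N = "\<lambda>k. complex_of_real (norm z ^ (2 * (k - 1)))"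
  have "((\<lambda>i. mode_coeff a b i * mode i z) has_sum
      (\<Sum>k=1..p. ?N k * h k z + ?N k * cnj (g k z))) (harmonics p)"
  proof (rule has_sum_harmonics)
    fix k assume k: "k \<in> {1..p}"
    show "((\<lambda>j. mode_coeff a b (k, int j) * mode (k, int j) z) has_sum ?N k * h k z) {1..}"
      using has_sum_cmult_right[OF hs[OF k], of "?N k"]
      by (simp add: mode_coeff_def mode_def mult_ac)
    have "((\<lambda>j. ?N k * cnj (b k j * z ^ j)) has_sum ?N k * cnj (g k z)) {1..}"
      by (intro has_sum_cmult_right) (simp only: has_sum_cnj_iff gs[OF k])
    then show "((\<lambda>j. mode_coeff a b (k, - int j) * mode (k, - int j) z) has_sum ?N k * cnj (g k z)) {1..}"
      by (rule has_sum_cong[THEN iffD1, rotated]) (auto simp: mode_coeff_def mode_def mult_ac)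
  qed
  then have "((\<lambda>i. mode_coeff a b i * mode i z) has_sum F z) (harmonics p)"
    unfolding F by (simp add: distrib_left)
  \<comment> \<open>The mode \<open>(1, 1)\<close> is \<open>z\<close> itself with coefficient
    \<open>a 1 1 = 1\<close>; removing it leaves the perturbation of the identity.\<close>
  from has_sum_remove[OF this, of "(1, 1)"] show ?thesis
    using p a11 by (simp add: harmonics_def mode_coeff_def mode_def)
qed

lemma has_sum_weight_row:
  fixes x :: "nat \<Rightarrow> complex"
  assumes "((\<lambda>j. real (2 * (k - 1) + j\<^sup>2) * norm (x j)) has_sum S) {2..}"
    and w: "\<And>j. w j = real (2 * (k - 1) + j\<^sup>2) * (if j = 1 then 1 else \<rho>)"
  shows "((\<lambda>j. w j * norm (x j)) has_sum (real (2 * (k - 1) + 1) * norm (x 1) + \<rho> * S)) {1..}"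
proof -
  have "((\<lambda>j. w j * norm (x j)) has_sum (\<rho> * S)) {2..}"
    using has_sum_cmult_right[OF assms(1), of \<rho>]
    by (rule has_sum_cong[THEN iffD1, rotated]) (auto simp: w)
  then have "((\<lambda>j. w j * norm (x j)) has_sum (w 1 * norm (x 1) + \<rho> * S)) (insert 1 {2..})"
    by (intro has_sum_insert) auto
  moreover have "insert 1 {2..} = {1::nat..}" by auto
  ultimately show ?thesis by (simp add: w)
qed

text \<open>Let s1 collect the terms of degree 1 apart from \<open>a 1 1\<close>, and s2 those of
  degree at least 2. Then L = s1 + \<open>\<rho>\<close> s2 <= s1 + \<open>\<rho>\<close> (1 - s1) <
  1, where the last step uses s1 < 1, the second condition on the class.\<close>

lemma HC_class_modes:
  assumes p: "p \<ge> 1" and F: "F \<in> HC_class p"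
  obtains a b where "polyharmonic_expansion p a b F"
    and "\<And>\<rho>. 0 \<le> \<rho> \<Longrightarrow> \<rho> < 1 \<Longrightarrow>
      \<exists>L<1. ((\<lambda>i. weight \<rho> i * norm (mode_coeff a b i)) has_sum L) (harmonics p - {(1, 1)})"
proof -
  obtain a b where ex: "polyharmonic_expansion p a b F"
    and sm: "\<And>k. k\<in>{1..p} \<Longrightarrow>
      (\<lambda>j. real (2 * (k - 1) + j\<^sup>2) * (norm (a k j) + norm (b k j))) summable_on {2..}"
    and le: "(\<Sum>k=1..p. \<Sum>\<^sub>\<infinity>j\<in>{2..}. real (2 * (k - 1) + j\<^sup>2) * (norm (a k j) + norm (b k j)))
      \<le> 1 - norm (b 1 1) - (\<Sum>k=2..p. real (2 * k - 1) * (norm (a k 1) + norm (b k 1)))"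
    and lt: "norm (b 1 1) + (\<Sum>k=2..p. real (2 * k - 1) * (norm (a k 1) + norm (b k 1))) < 1"
    using F unfolding HC_class_def by blast
  have "\<exists>L<1. ((\<lambda>i. weight \<rho> i * norm (mode_coeff a b i)) has_sum L) (harmonics p - {(1, 1)})"
    if \<rho>: "0 \<le> \<rho>" "\<rho> < 1" for \<rho>
  proof -
    define A where "A k = (\<Sum>\<^sub>\<infinity>j\<in>{2..}. real (2 * (k - 1) + j\<^sup>2) * norm (a k j))" for k
    define B where "B k = (\<Sum>\<^sub>\<infinity>j\<in>{2..}. real (2 * (k - 1) + j\<^sup>2) * norm (b k j))" for k
    have As: "((\<lambda>j. real (2 * (k - 1) + j\<^sup>2) * norm (a k j)) has_sum A k) {2..}"
      and Bs: "((\<lambda>j. real (2 * (k - 1) + j\<^sup>2) * norm (b k j)) has_sum B k) {2..}"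
      if k: "k \<in> {1..p}" for k
      unfolding A_def B_def
      by (intro has_sum_infsum summable_on_comparison_test[OF sm[OF k]] mult_left_mono; simp)+
    have AB: "(\<Sum>\<^sub>\<infinity>j\<in>{2..}. real (2 * (k - 1) + j\<^sup>2) * (norm (a k j) + norm (b k j))) = A k + B k"
      if k: "k \<in> {1..p}" for k
      using has_sum_add[OF As[OF k] Bs[OF k]] by (intro infsumI) (simp add: distrib_left)
    define H where "H k = real (2 * (k - 1) + 1) * (norm (a k 1) + norm (b k 1))" for k
    have "((\<lambda>i. weight \<rho> i * norm (mode_coeff a b i)) has_sum
      (\<Sum>k=1..p. (real (2 * (k - 1) + 1) * norm (a k 1) + \<rho> * A k) +
         (real (2 * (k - 1) + 1) * norm (b k 1) + \<rho> * B k))) (harmonics p)"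
    proof (rule has_sum_harmonics)
      fix k assume k: "k \<in> {1..p}"
      have w: "weight \<rho> (k, int j) = real (2 * (k - 1) + j\<^sup>2) * (if j = 1 then 1 else \<rho>)"
        "weight \<rho> (k, - int j) = real (2 * (k - 1) + j\<^sup>2) * (if j = 1 then 1 else \<rho>)" for j
        by (auto simp: weight_def)
      show "((\<lambda>j. weight \<rho> (k, int j) * norm (mode_coeff a b (k, int j))) has_sum
          (real (2 * (k - 1) + 1) * norm (a k 1) + \<rho> * A k)) {1..}"
        using has_sum_weight_row[OF As[OF k] w(1)] by (simp add: mode_coeff_def)
      show "((\<lambda>j. weight \<rho> (k, - int j) * norm (mode_coeff a b (k, - int j))) has_sum
          (real (2 * (k - 1) + 1) * norm (b k 1) + \<rho> * B k)) {1..}"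
        using has_sum_weight_row[OF Bs[OF k] w(2)]
        by (rule has_sum_cong[THEN iffD1, rotated]) (auto simp: mode_coeff_def)
    qed
    also have "(\<Sum>k=1..p. (real (2 * (k - 1) + 1) * norm (a k 1) + \<rho> * A k) +
         (real (2 * (k - 1) + 1) * norm (b k 1) + \<rho> * B k)) = (\<Sum>k=1..p. H k + \<rho> * (A k + B k))"
      by (intro sum.cong) (auto simp: H_def algebra_simps)
    finally have tot: "((\<lambda>i. weight \<rho> i * norm (mode_coeff a b i)) has_sum
      (\<Sum>k=1..p. H k + \<rho> * (A k + B k))) (harmonics p)" .
    \<comment> \<open>The subtracted 1 is the weight of the mode \<open>(1, 1)\<close>.\<close>
    have "((\<lambda>i. weight \<rho> i * norm (mode_coeff a b i)) has_sum
        ((\<Sum>k=1..p. H k + \<rho> * (A k + B k)) - 1)) (harmonics p - {(1, 1)})"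
      using has_sum_remove[OF tot, of "(1, 1)"] p ex
      by (simp add: harmonics_def weight_def mode_coeff_def polyharmonic_expansion_def)
    moreover have "(\<Sum>k=1..p. H k + \<rho> * (A k + B k)) - 1 < 1"
    proof -
      define s1 where "s1 = norm (b 1 1) + (\<Sum>k=2..p. real (2 * k - 1) * (norm (a k 1) + norm (b k 1)))"
      define s2 where "s2 = (\<Sum>k=1..p. A k + B k)"
      have "(\<Sum>k=1..p. H k) = H 1 + (\<Sum>k=2..p. H k)"
        using p by (simp add: sum.atLeast_Suc_atMost numeral_2_eq_2)
      \<comment> \<open>The weights 2 (k - 1) + 1 and 2 k - 1 agree under the truncated subtraction
        because k >= 1.\<close>
      also have "(\<Sum>k=2..p. H k) = (\<Sum>k=2..p. real (2 * k - 1) * (norm (a k 1) + norm (b k 1)))"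
        by (intro sum.cong) (auto simp: H_def of_nat_diff)
      also have "H 1 = 1 + norm (b 1 1)"
        using ex by (simp add: H_def polyharmonic_expansion_def)
      finally have "(\<Sum>k=1..p. H k + \<rho> * (A k + B k)) - 1 = s1 + \<rho> * s2"
        by (simp add: s1_def s2_def sum.distrib flip: sum_distrib_left)
      moreover have "s2 \<le> 1 - s1"
        using le AB unfolding s2_def s1_def by simp
      then have "\<rho> * s2 \<le> \<rho> * (1 - s1)" using \<rho> by (intro mult_left_mono)
      moreover have "\<rho> * (1 - s1) < 1 * (1 - s1)"
        using lt \<rho> by (intro mult_strict_right_mono) (auto simp: s1_def)
      ultimately show ?thesis by simp
    qed
    ultimately show ?thesis by blast
  qed
  then show ?thesis using that ex by blast
qed

section \<open>Lipschitz and size bounds for the modes\<close>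

lemma mode_lipschitz:
  assumes "norm z \<le> \<rho>" "norm w \<le> \<rho>" "\<rho> \<le> 1" "snd i \<noteq> 0"
  shows "norm (mode i z - mode i w) \<le> weight \<rho> i * norm (z - w)"
proof -
  have \<rho>0: "0 \<le> \<rho>" using assms(1) norm_ge_zero order_trans by blast
  \<comment> \<open>Product rule in Lipschitz form: the power varies at rate at most j
    \<open>\<rho>\<close>^(j-1), the radial factor at rate at most 2 m, and the cofactors are
    bounded by 1 and \<open>\<rho>\<close>^j. Negative frequencies reduce to this by conjugating
    both points.\<close>
  have main: "norm (of_real (norm z ^ (2 * m)) * z ^ j - of_real (norm w ^ (2 * m)) * w ^ j)
      \<le> (real (2 * m) + (real j)\<^sup>2) * (if j = 1 then 1 else \<rho>) * norm (z - w)"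
    if zw: "norm z \<le> \<rho>" "norm w \<le> \<rho>" and j: "j \<noteq> 0" for m j and z w :: complex
  proof -
    let ?e = "if j = 1 then 1 else \<rho>"
    have e0: "0 \<le> ?e" using \<rho>0 by simp
    obtain l where l: "j = Suc l" using j not0_implies_Suc by blast
    \<comment> \<open>For j >= 2 at least one factor \<open>\<rho>\<close> survives, which is the
      damping in \<open>weight\<close>.\<close>
    have pw: "\<rho> ^ l \<le> ?e"
      using l assms(3) \<rho>0 power_decreasing[of 1 l \<rho>] by (cases l) auto
    have 1: "norm (z ^ j - w ^ j) \<le> (real j)\<^sup>2 * ?e * norm (z - w)"
    proof -
      have "norm (z ^ j - w ^ j) \<le> real j * \<rho> ^ l * norm (z - w)"
        using norm_power_diff_le_radius[OF zw, of l] l by simp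
      also have "\<dots> \<le> (real j)\<^sup>2 * ?e * norm (z - w)"
        using pw e0 \<rho>0 j by (intro mult_right_mono mult_mono self_le_power) auto
      finally show ?thesis .
    qed
    have 2: "\<bar>norm z ^ (2 * m) - norm w ^ (2 * m)\<bar> \<le> real (2 * m) * norm (z - w)"
    proof -
      have "\<bar>norm z ^ (2 * m) - norm w ^ (2 * m)\<bar> \<le> real (2 * m) * \<bar>norm z - norm w\<bar>"
        using norm_power_diff[of "norm z" "norm w" "2 * m"] zw assms(3) by simp
      also have "\<dots> \<le> real (2 * m) * norm (z - w)"
        by (intro mult_left_mono norm_triangle_ineq3) auto
      finally show ?thesis .
    qed
    have 3: "norm (w ^ j) \<le> ?e"
    proof -
      have "norm (w ^ j) \<le> \<rho> ^ j" using zw by (simp add: norm_power power_mono)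
      also have "\<dots> \<le> \<rho> ^ l" using l \<rho>0 assms(3) by (simp add: mult_left_le_one_le)
      finally show ?thesis using pw by linarith
    qed
    have 4: "norm z ^ (2 * m) \<le> 1" using zw assms(3) by (intro power_le_one) auto
    have "of_real (norm z ^ (2 * m)) * z ^ j - of_real (norm w ^ (2 * m)) * w ^ j =
      of_real (norm z ^ (2 * m)) * (z ^ j - w ^ j) + of_real (norm z ^ (2 * m) - norm w ^ (2 * m)) * w ^ j"
      by (simp add: algebra_simps)
    also have "norm \<dots> \<le> 1 * ((real j)\<^sup>2 * ?e * norm (z - w)) + (real (2 * m) * norm (z - w)) * ?e"
      using 1 2 3 4 by (intro norm_triangle_le add_mono; unfold norm_mult norm_of_real; intro mult_mono; simp)
    finally show ?thesis by (simp add: algebra_simps)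
  qed
  show ?thesis
  proof (cases "snd i \<ge> 0")
    case True
    then show ?thesis
      using main[OF assms(1,2), of "nat (snd i)" "fst i - 1"] assms(4)
      by (simp add: mode_def weight_def nat_eq_iff)
  next
    case False
    have "norm (cnj z - cnj w) = norm (z - w)" by (metis complex_cnj_diff complex_mod_cnj)
    then show ?thesis
      using main[of "cnj z" "cnj w" "nat (- snd i)" "fst i - 1"] assms False
      by (simp add: mode_def weight_def nat_eq_iff)
  qed
qed

lemma mode_circle:
  assumes "0 \<le> r"
  shows "mode i (of_real r * cis \<theta>) =
    of_real (r ^ (2 * (fst i - 1) + nat \<bar>snd i\<bar>)) * cis (of_int (snd i) * \<theta>)"
proof -
  have n: "norm (of_real r * cis \<theta>) = r" using assms by (simp add: norm_mult)
  have "(if snd i \<ge> 0 then (of_real r * cis \<theta>) ^ nat (snd i) else cnj (of_real r * cis \<theta>) ^ nat (- snd i))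
    = of_real (r ^ nat \<bar>snd i\<bar>) * cis (of_int (snd i) * \<theta>)"
    by (auto simp: power_mult_distrib Complex.DeMoivre cis_cnj)
  then show ?thesis
    unfolding mode_def n by (simp add: power_add)
qed

text \<open>The exponent is at least 1, and at least 2 unless |n| = 1. One factor \<open>r\<close>
  is pulled out because on the circle of radius \<open>r\<close> the leading term has norm
  \<open>r\<close>, not 1.\<close>

lemma power_le_weight:
  assumes "0 \<le> r" "r \<le> 1" "snd i \<noteq> 0"
  shows "(of_int (snd i))\<^sup>2 * r ^ (2 * (fst i - 1) + nat \<bar>snd i\<bar>) \<le> r * weight r i"
proof -
  let ?N = "2 * (fst i - 1) + nat \<bar>snd i\<bar>"
  have "r ^ ?N \<le> r * (if \<bar>snd i\<bar> = 1 then 1 else r)"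
  proof (cases "\<bar>snd i\<bar> = 1")
    case True
    then show ?thesis using power_decreasing[of 1 ?N r] assms by simp
  next
    case False
    then have "2 \<le> ?N" using assms(3) by linarith
    then show ?thesis using power_decreasing[of 2 ?N r] assms False by (simp add: power2_eq_square)
  qed
  then have "(of_int (snd i))\<^sup>2 * r ^ ?N
      \<le> (real (2 * (fst i - 1)) + of_int ((snd i)\<^sup>2)) * (r * (if \<bar>snd i\<bar> = 1 then 1 else r))"
    using assms by (intro mult_mono) auto
  then show ?thesis by (simp add: weight_def algebra_simps)
qed

text \<open>If \<open>D = 0\<close>, the increments of \<open>f\<close> at \<open>\<theta>\<close>
  are of smaller order than those of the parameter; the expansion passes this on to
  \<open>g\<close>, whose derivative would then vanish.\<close>

lemma has_vector_derivative_nonzero_if_expanding: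
  fixes f g :: "real \<Rightarrow> complex"
  assumes f: "(f has_vector_derivative D) (at \<theta>)" and g: "(g has_vector_derivative E) (at \<theta>)"
    and "E \<noteq> 0" "\<kappa> > 0" and ex: "\<And>t. \<kappa> * norm (g t - g \<theta>) \<le> norm (f t - f \<theta>)"
  shows "D \<noteq> 0"
proof
  assume "D = 0"
  have f0: "\<And>e. e > 0 \<Longrightarrow> \<exists>d>0. \<forall>y. norm (y - \<theta>) < d \<longrightarrow> norm (f y - f \<theta>) \<le> e * norm (y - \<theta>)"
    using f \<open>D = 0\<close> unfolding has_vector_derivative_def has_derivative_at_alt by simp
  have "(g has_vector_derivative 0) (at \<theta>)"
    unfolding has_vector_derivative_def has_derivative_at_alt
  proof (intro conjI allI impI)
    fix e :: real assume "e > 0"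
    then obtain d where d: "d > 0"
      "\<And>y. norm (y - \<theta>) < d \<Longrightarrow> norm (f y - f \<theta>) \<le> (e * \<kappa>) * norm (y - \<theta>)"
      using f0[of "e * \<kappa>"] \<open>\<kappa> > 0\<close> by auto
    have "norm (g y - g \<theta>) \<le> e * norm (y - \<theta>)" if "norm (y - \<theta>) < d" for y
    proof -
      have "\<kappa> * norm (g y - g \<theta>) \<le> \<kappa> * (e * norm (y - \<theta>))"
        using order_trans[OF ex d(2)[OF that]] by (simp add: mult_ac)
      then show ?thesis using \<open>\<kappa> > 0\<close> by simp
    qed
    then show "\<exists>d>0. \<forall>y. norm (y - \<theta>) < d \<longrightarrow> norm (g y - g \<theta> - (y - \<theta>) *\<^sub>R 0) \<le> e * norm (y - \<theta>)"
      using d(1) by auto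
  qed simp
  then show False using g \<open>E \<noteq> 0\<close> vector_derivative_unique_at by blast
qed

section \<open>Expansion on discs, support on circles, and convexity\<close>

lemma expanding_on_cball:
  assumes p: "p \<ge> 1" and ex: "polyharmonic_expansion p a b F" and \<rho>: "0 \<le> \<rho>" "\<rho> < 1"
    and L: "((\<lambda>i. weight \<rho> i * norm (mode_coeff a b i)) has_sum L) (harmonics p - {(1, 1)})"
    and zw: "norm z \<le> \<rho>" "norm w \<le> \<rho>"
  shows "(1 - L) * norm (z - w) \<le> norm (F z - F w)"
proof -
  have s: "((\<lambda>i. mode_coeff a b i * mode i v) has_sum (F v - v)) (harmonics p - {(1, 1)})"
    if "norm v \<le> \<rho>" for v
    using expansion_has_sum_modes[OF p ex] that \<rho> by simp
  \<comment> \<open>The perturbation of the identity has Lipschitz constant at most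
    \<open>L\<close>, which leaves a net expansion of 1 - L.\<close>
  have "norm ((F z - z) - (F w - w)) \<le> L * norm (z - w)"
  proof (rule norm_infsum_le)
    show "((\<lambda>i. mode_coeff a b i * mode i z - mode_coeff a b i * mode i w) has_sum
        ((F z - z) - (F w - w))) (harmonics p - {(1, 1)})"
      using has_sum_add[OF s[OF zw(1)] has_sum_uminusI[OF s[OF zw(2)]]] by (simp only: diff_conv_add_uminus)
    show "((\<lambda>i. weight \<rho> i * norm (mode_coeff a b i) * norm (z - w)) has_sum (L * norm (z - w)))
        (harmonics p - {(1, 1)})"
      by (rule has_sum_cmult_left[OF L])
    fix i assume "i \<in> harmonics p - {(1, 1)}"
    then have "snd i \<noteq> 0" by (auto simp: harmonics_def)
    then have "norm (mode_coeff a b i) * norm (mode i z - mode i w)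
        \<le> norm (mode_coeff a b i) * (weight \<rho> i * norm (z - w))"
      using mode_lipschitz[OF zw] \<rho> by (intro mult_left_mono) auto
    then show "norm (mode_coeff a b i * mode i z - mode_coeff a b i * mode i w)
        \<le> weight \<rho> i * norm (mode_coeff a b i) * norm (z - w)"
      unfolding right_diff_distrib[symmetric] norm_mult by (simp add: mult_ac)
  qed
  moreover have "norm (z - w) - norm ((F z - z) - (F w - w)) \<le> norm (F z - F w)"
    using norm_triangle_ineq4[of "F z - F w" "(F z - z) - (F w - w)"] by simp
  ultimately show ?thesis by (simp add: algebra_simps)
qed

text \<open>Any point of the circle is made the base point: with y = x \<open>cis \<phi>\<close>,
  each mode at \<open>y\<close> is its value at \<open>x\<close> times a character of
  \<open>\<phi>\<close>. So the series lemma applies with leading coefficient \<open>x\<close> of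
  norm \<open>r\<close>, and its moment is at most r L < r.\<close>

lemma circle_support:
  assumes p: "p \<ge> 1" and ex: "polyharmonic_expansion p a b F" and r: "0 < r" "r < 1"
    and L: "((\<lambda>i. weight r i * norm (mode_coeff a b i)) has_sum L) (harmonics p - {(1, 1)})" "L < 1"
    and x: "x \<in> sphere 0 r"
  shows "\<exists>v. v \<noteq> 0 \<and> (\<forall>y\<in>sphere 0 r. v \<bullet> F y \<le> v \<bullet> F x)"
proof -
  let ?J = "harmonics p - {(1::nat, 1::int)}"
  obtain \<theta> where x_eq: "x = of_real r * cis \<theta>"
    using x by (metis mem_sphere_0 rcis_cmod_Arg rcis_def)
  define d where "d = (\<lambda>i. mode_coeff a b i * mode i x)"
  have mode_rot: "mode i (x * cis \<phi>) = mode i x * cis (of_int (snd i) * \<phi>)" for i \<phi>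
    unfolding x_eq mult.assoc cis_mult mode_circle[OF less_imp_le[OF r(1)]]
    by (simp add: cis_mult algebra_simps)
  have nd: "(of_int (snd i))\<^sup>2 * norm (d i) \<le> r * (weight r i * norm (mode_coeff a b i))"
    if "i \<in> ?J" for i
  proof -
    have "norm (mode i x) = r ^ (2 * (fst i - 1) + nat \<bar>snd i\<bar>)"
      unfolding x_eq using r by (simp add: mode_circle norm_mult norm_power)
    moreover have "snd i \<noteq> 0" using that by (auto simp: harmonics_def)
    ultimately show ?thesis
      using mult_left_mono[OF power_le_weight[of r i] norm_ge_zero[of "mode_coeff a b i"]] r
      by (simp add: d_def norm_mult mult_ac)
  qed
  have rL: "((\<lambda>i. r * (weight r i * norm (mode_coeff a b i))) has_sum (r * L)) ?J"
    by (rule has_sum_cmult_right[OF L(1)])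
  have "(\<lambda>i. (of_int (snd i))\<^sup>2 * norm (d i)) summable_on ?J"
    by (rule summable_on_comparison_test[OF has_sum_imp_summable[OF rL]]) (use nd in auto)
  then obtain M where M: "((\<lambda>i. (of_int (snd i))\<^sup>2 * norm (d i)) has_sum M) ?J"
    by (auto simp: summable_on_def)
  have "M \<le> r * L" by (rule has_sum_mono[OF M rL nd])
  also have "r * L < r" using r L(2) by simp
  finally have M_less: "M < norm x" using x by simp
  have s: "((\<lambda>i. mode_coeff a b i * mode i v) has_sum (F v - v)) ?J" if "norm v = r" for v
    using expansion_has_sum_modes[OF p ex] that r by simp
  have sd: "(d has_sum (F x - x)) ?J"
    unfolding d_def using x by (intro s) simp
  obtain V where V: "V \<noteq> 0"
    "\<And>\<phi> t. ((\<lambda>i. d i * cis (of_int (snd i) * \<phi>)) has_sum t) ?J \<Longrightarrow>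
      Re (cnj V * (x * cis \<phi> + t)) \<le> Re (cnj V * (x + (F x - x)))"
    using trigonometric_series_support[OF M M_less sd] by blast
  have "V \<bullet> F y \<le> V \<bullet> F x" if y: "y \<in> sphere 0 r" for y
  proof -
    obtain \<psi> where "y = of_real r * cis \<psi>"
      using y by (metis mem_sphere_0 rcis_cmod_Arg rcis_def)
    then have y_eq: "y = x * cis (\<psi> - \<theta>)" by (simp add: x_eq cis_mult)
    have "((\<lambda>i. d i * cis (of_int (snd i) * (\<psi> - \<theta>))) has_sum (F y - y)) ?J"
      using s[of y] y unfolding d_def mult.assoc mode_rot[symmetric] y_eq[symmetric] by simp
    from V(2)[OF this] show ?thesis
      unfolding y_eq[symmetric] by (simp add: inner_complex_def)
  qed
  then show ?thesis using V(1) by blast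
qed

lemma image_circle_eq_sphere:
  assumes "0 \<le> r"
  shows "(\<lambda>\<theta>. of_real r * cis \<theta>) ` {0..2 * pi} = sphere 0 r"
proof
  show "sphere 0 r \<subseteq> (\<lambda>\<theta>. of_real r * cis \<theta>) ` {0..2 * pi}"
  proof
    fix x :: complex assume "x \<in> sphere 0 r"
    then have "x = of_real r * cis (Arg2pi x)"
      using Arg2pi_eq[of x] by (simp add: cis_conv_exp)
    then show "x \<in> (\<lambda>\<theta>. of_real r * cis \<theta>) ` {0..2 * pi}"
      using Arg2pi_ge_0[of x] Arg2pi_lt_2pi[of x] by (intro image_eqI[of _ _ "Arg2pi x"]) auto
  qed
qed (use assms in \<open>auto simp: norm_mult\<close>)

theorem theorem4:
  fixes p :: nat and F :: "complex \<Rightarrow> complex"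
  assumes "p \<ge> 1" and "F \<in> HC_class p"
  shows "convex_polyharmonic p F"
proof -
  obtain a b where ex: "polyharmonic_expansion p a b F"
    and L: "\<And>\<rho>. 0 \<le> \<rho> \<Longrightarrow> \<rho> < 1 \<Longrightarrow>
      \<exists>L<1. ((\<lambda>i. weight \<rho> i * norm (mode_coeff a b i)) has_sum L) (harmonics p - {(1, 1)})"
    using HC_class_modes[OF assms] by blast
  have poly: "polyharmonic_on p \<bbbD> F" by (rule expansion_polyharmonic[OF ex])
  have expand: "\<exists>\<kappa>>0. \<forall>z w. norm z \<le> \<rho> \<longrightarrow> norm w \<le> \<rho> \<longrightarrow> \<kappa> * norm (z - w) \<le> norm (F z - F w)"
    if \<rho>: "0 \<le> \<rho>" "\<rho> < 1" for \<rho>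
  proof -
    obtain M where "M < 1"
      "((\<lambda>i. weight \<rho> i * norm (mode_coeff a b i)) has_sum M) (harmonics p - {(1, 1)})"
      using L[OF \<rho>] by blast
    then show ?thesis
      using expanding_on_cball[OF assms(1) ex \<rho>] by (intro exI[of _ "1 - M"]) auto
  qed
  have inj: "inj_on F \<bbbD>"
  proof (rule inj_onI)
    fix z w :: complex assume zw: "z \<in> \<bbbD>" "w \<in> \<bbbD>" "F z = F w"
    \<comment> \<open>The expansion factor depends on the radius, so each pair of points uses the
      smallest closed disc about 0 that contains both.\<close>
    have "max (norm z) (norm w) < 1" "0 \<le> max (norm z) (norm w)" using zw by (auto simp: le_max_iff_disj)
    from expand[OF this(2,1)] obtain \<kappa> where "\<kappa> > 0" "\<kappa> * norm (z - w) \<le> norm (F z - F w)" by auto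
    then show "z = w" using zw(3) by (simp add: mult_le_0_iff)
  qed
  have F0: "F 0 = 0"
  proof -
    have "((\<lambda>i. mode_coeff a b i * mode i 0) has_sum (F 0 - 0)) (harmonics p - {(1, 1)})"
      by (rule expansion_has_sum_modes[OF assms(1) ex]) simp
    moreover have "((\<lambda>i. mode_coeff a b i * mode i 0) has_sum 0) (harmonics p - {(1, 1)})"
      by (rule has_sum_0) (auto simp: mode_def harmonics_def)
    ultimately show ?thesis using has_sum_unique by fastforce
  qed
  have diff: "F differentiable (at z)" if "z \<in> \<bbbD>" for z
  proof -
    \<comment> \<open>A positive order exposes the differentiability clause of
      \<open>times_cont_diff_on\<close>.\<close>
    obtain n where "2 * p = Suc n" using assms(1) by (cases "2 * p") auto
    then show ?thesis using poly that unfolding polyharmonic_on_def by simp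
  qed
  have deriv: "\<exists>D. D \<noteq> 0 \<and> ((\<lambda>t. F (of_real r * cis t)) has_vector_derivative D) (at \<theta>)"
    if r: "r \<in> {0<..<1}" for r \<theta> :: real
  proof -
    let ?c = "\<lambda>t. complex_of_real r * cis t"
    have c: "(?c has_vector_derivative (of_real r * (\<i> * cis \<theta>))) (at \<theta>)"
      unfolding has_vector_derivative_def
      by (auto intro!: derivative_eq_intros simp: scaleR_conv_of_real mult_ac)
    have "?c \<theta> \<in> \<bbbD>" using r by (simp add: norm_mult)
    then obtain F' where F': "(F has_derivative F') (at (?c \<theta>))"
      using diff unfolding differentiable_def by blast
    have "((F \<circ> ?c) has_vector_derivative F' (of_real r * (\<i> * cis \<theta>))) (at \<theta>)"
      using c F' vector_derivative_diff_chain_within[of ?c _ \<theta> UNIV F F']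
      by (metis has_derivative_at_withinI)
    then have d: "((\<lambda>t. F (?c t)) has_vector_derivative F' (of_real r * (\<i> * cis \<theta>))) (at \<theta>)"
      by (simp add: o_def)
    obtain \<kappa> where \<kappa>: "\<kappa> > 0"
      "\<And>z w. norm z \<le> r \<Longrightarrow> norm w \<le> r \<Longrightarrow> \<kappa> * norm (z - w) \<le> norm (F z - F w)"
      using expand[of r] r by auto
    \<comment> \<open>The comparison curve is the circle, whose velocity does not vanish;
      \<open>F\<close> expands it by \<open>\<kappa>\<close>.\<close>
    have "F' (of_real r * (\<i> * cis \<theta>)) \<noteq> 0"
    proof (rule has_vector_derivative_nonzero_if_expanding[OF d c _ \<kappa>(1)])
      show "\<kappa> * norm (?c t - ?c \<theta>) \<le> norm (F (?c t) - F (?c \<theta>))" for t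
        using r by (intro \<kappa>(2)) (auto simp: norm_mult)
    qed (use r in auto)
    then show ?thesis using d by blast
  qed
  have "convex (inside ((\<lambda>\<theta>. F (of_real r * cis \<theta>)) ` {0..2 * pi}))" if r: "r \<in> {0<..<1}" for r
  proof -
    obtain M where M: "((\<lambda>i. weight r i * norm (mode_coeff a b i)) has_sum M) (harmonics p - {(1, 1)})"
      "M < 1"
      using L[of r] r by auto
    have sub: "sphere 0 r \<subseteq> \<bbbD>" using r by auto
    have im: "path_image (F \<circ> circlepath 0 r) = F ` sphere 0 r"
      using r by (simp add: path_image_compose)
    have "simple_path (F \<circ> circlepath 0 r)"
    proof (rule simple_path_continuous_image)
      show "continuous_on (path_image (circlepath 0 r)) F"
        using r sub diff by (auto intro!: continuous_at_imp_continuous_on differentiable_imp_continuous_within)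
      show "inj_on F (path_image (circlepath 0 r))"
        using r inj_on_subset[OF inj sub] by simp
    qed (use r in \<open>simp add: simple_path_circlepath\<close>)
    moreover have "pathfinish (F \<circ> circlepath 0 r) = pathstart (F \<circ> circlepath 0 r)"
      by (simp add: pathfinish_compose pathstart_compose)
    moreover have "\<exists>v. v \<noteq> 0 \<and> (\<forall>y\<in>path_image (F \<circ> circlepath 0 r). v \<bullet> y \<le> v \<bullet> x)"
      if "x \<in> path_image (F \<circ> circlepath 0 r)" for x
      using circle_support[OF assms(1) ex _ _ M] r that unfolding im by fastforce
    ultimately have "convex (inside (path_image (F \<circ> circlepath 0 r)))"
      by (rule inside_convex_if_support)
    \<comment> \<open>The curve in the angle and the path over the unit interval differ only in
      parametrization, and \<open>inside\<close> sees only the common image.\<close>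
    moreover have "(\<lambda>\<theta>. F (of_real r * cis \<theta>)) ` {0..2 * pi} = F ` sphere 0 r"
      using r by (simp add: image_circle_eq_sphere[symmetric] image_image)
    ultimately show ?thesis by (simp add: im)
  qed
  then show ?thesis
    unfolding convex_polyharmonic_def using poly inj F0 deriv by blast
qed

end
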